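(* Let $u$ be an input trajectory. For $t\ge 0$, $u$ is a universal input trajectory on $[0,t]$ if and only if, for any $x_0\in\mathbb{R}^{n_x}$, $x_0$ is the unique global solution of the full information estimation problem $$\inf_{\xi\in\mathbb{R}^{n_x}}l(0,t,x_0,\xi,u).$$
   Context: Let $n_x,n_u,n_y$ be positive integers, $\mathbb{R}^+=[0,\infty)$, $U\subset\mathbb{R}^{n_u}$, and $f:\mathbb{R}^{n_x}\times\mathbb{R}^{n_u}\to\mathbb{R}^{n_x}$, $h:\mathbb{R}^{n_x}\times\mathbb{R}^{n_u}\to\mathbb{R}^{n_y}$ be twice continuously differentiable. The system is $\dot{x}=f(x,u)$, $y=h(x,u)$. An input trajectory is a piecewise continuous map $u:\mathbb{R}^+\to U$. Solutions are assumed to be uniquely defined at all times; $\phi_f(s_2;s_1,\xi,u)$ is the solution at time $s_2\ge s_1\ge 0$ starting from $\xi$ at time $s_1$ with input $u$. $\|\cdot\|$ is the Euclidean norm. Cumulative output error: $l(t_1,t_2,\xi_1,\xi_2,u)=\int_{t_1}^{t_2}\|h(\phi_f(s;t_1,\xi_1,u),u(s))-h(\phi_f(s;t_1,\xi_2,u),u(s))\|^2\,\mathrm{d}s$ for $0\le t_1\le t_2$. $u$ is a universal input trajectory on $[0,t]$ if for any $\xi_1\ne\xi_2$ there exists $s\in[0,t]$ such that $h(\phi_f(s;0,\xi_1,u),u(s))\ne h(\phi_f(s;0,\xi_2,u),u(s))$. $\xi^*$ is a global solution of $\inf_{\xi\in\mathbb{R}^{n_x}}F(\xi)$ if $F(\xi^*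 )\le F(\xi)$ for all $\xi\in\mathbb{R}^{n_x}$.
   Formalization: Proved for t > 0 instead of t ≥ 0, for u left-continuous at t, and with piecewise continuous inputs whose value at each jump is one of the one-sided limits (the right limit at time 0); without these the equivalence can fail. *)

theory Defs
  imports "HOL-Analysis.Analysis"
begin

definition twice_cont_diff :: "('a::real_normed_vector \<Rightarrow> 'b::real_normed_vector) \<Rightarrow> bool" where
  "twice_cont_diff g \<longleftrightarrow>
     (\<exists>(g' :: 'a \<Rightarrow> 'a \<Rightarrow>\<^sub>L 'b) (g'' :: 'a \<Rightarrow> 'a \<Rightarrow>\<^sub>L ('a \<Rightarrow>\<^sub>L 'b)).
        (\<forall>z. (g has_derivative blinfun_apply (g' z)) (at z)) \<and>
        (\<forall>z. (g' has_derivative blinfun_apply (g'' z)) (at z)) \<and>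
        continuous_on UNIV g'')"

(* Maps on [0,\<infinity>) are total functions on the reals whose values at negative times are never used.
   Besides finitely many discontinuities per bounded interval and finite one-sided limits, we use
   the usual convention that the value at a jump is one of the two one-sided limits (at time 0,
   the right limit).  Without it, the value at a jump could be altered at will without affecting
   any solution or integral. *)
definition piecewise_continuous :: "(real \<Rightarrow> 'a::topological_space) \<Rightarrow> bool" where
  "piecewise_continuous u \<longleftrightarrow>
     (\<forall>T. finite {s \<in> {0..T}. \<not> continuous (at s within {0..}) u}) \<and>
     (\<forall>s\<ge>0. \<exists>l. (u \<longlongrightarrow> l) (at_right s)) \<and>
     (\<forall>s>0. \<exists>l. (u \<longlongrightarrow> l) (at_left s)) \<and>
     (\<forall>s\<ge>0. continuous (at_right s) u \<or> (0 < s \<and> continuous (at_left s) u))"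

definition input_trajectory :: "(real ^ 'nu) set \<Rightarrow> (real \<Rightarrow> real ^ 'nu) \<Rightarrow> bool" where
  "input_trajectory U u \<longleftrightarrow> piecewise_continuous u \<and> (\<forall>s\<ge>0. u s \<in> U)"

(* Solution on [s1,\<infinity>) for a piecewise continuous input: continuous everywhere, with the
   differential equation imposed except at the discontinuities of the input. *)
definition is_solution ::
  "((real ^ 'nx) \<times> (real ^ 'nu) \<Rightarrow> real ^ 'nx) \<Rightarrow> real \<Rightarrow> real ^ 'nx \<Rightarrow>
   (real \<Rightarrow> real ^ 'nu) \<Rightarrow> (real \<Rightarrow> real ^ 'nx) \<Rightarrow> bool" where
  "is_solution f s1 \<xi> u x \<longleftrightarrow>
     x s1 = \<xi> \<and> continuous_on {s1..} x \<and>
     (\<forall>s\<ge>s1. continuous (at s within {0..}) u \<longrightarrow>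
        (x has_vector_derivative f (x s, u s)) (at s within {s1..}))"

definition solutions_uniquely_defined ::
  "(real ^ 'nu) set \<Rightarrow> ((real ^ 'nx) \<times> (real ^ 'nu) \<Rightarrow> real ^ 'nx) \<Rightarrow> bool" where
  "solutions_uniquely_defined U f \<longleftrightarrow>
     (\<forall>u s1 \<xi>. input_trajectory U u \<longrightarrow> 0 \<le> s1 \<longrightarrow>
        (\<exists>x. is_solution f s1 \<xi> u x) \<and>
        (\<forall>x y. is_solution f s1 \<xi> u x \<longrightarrow> is_solution f s1 \<xi> u y \<longrightarrow> (\<forall>s\<ge>s1. x s = y s)))"

(* Argument order as in \<phi>_f(s2; s1, \<xi>, u). *)
definition \<phi> ::
  "((real ^ 'nx) \<times> (real ^ 'nu) \<Rightarrow> real ^ 'nx) \<Rightarrow> real \<Rightarrow> real \<Rightarrow> real ^ 'nx \<Rightarrow>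
   (real \<Rightarrow> real ^ 'nu) \<Rightarrow> real ^ 'nx" where
  "\<phi> f s2 s1 \<xi> u = (THE v. \<exists>x. is_solution f s1 \<xi> u x \<and> x s2 = v)"

definition cumulative_output_error ::
  "((real ^ 'nx) \<times> (real ^ 'nu) \<Rightarrow> real ^ 'nx) \<Rightarrow> ((real ^ 'nx) \<times> (real ^ 'nu) \<Rightarrow> real ^ 'ny) \<Rightarrow>
   real \<Rightarrow> real \<Rightarrow> real ^ 'nx \<Rightarrow> real ^ 'nx \<Rightarrow> (real \<Rightarrow> real ^ 'nu) \<Rightarrow> real" where
  "cumulative_output_error f h t1 t2 \<xi>1 \<xi>2 u =
     integral {t1..t2} (\<lambda>s. (norm (h (\<phi> f s t1 \<xi>1 u, u s) - h (\<phi> f s t1 \<xi>2 u, u s)))\<^sup>2)"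

definition universal_input_trajectory ::
  "((real ^ 'nx) \<times> (real ^ 'nu) \<Rightarrow> real ^ 'nx) \<Rightarrow> ((real ^ 'nx) \<times> (real ^ 'nu) \<Rightarrow> real ^ 'ny) \<Rightarrow>
   (real \<Rightarrow> real ^ 'nu) \<Rightarrow> real \<Rightarrow> bool" where
  "universal_input_trajectory f h u t \<longleftrightarrow>
     (\<forall>\<xi>1 \<xi>2. \<xi>1 \<noteq> \<xi>2 \<longrightarrow>
        (\<exists>s\<in>{0..t}. h (\<phi> f s 0 \<xi>1 u, u s) \<noteq> h (\<phi> f s 0 \<xi>2 u, u s)))"

definition global_solution :: "('a \<Rightarrow> real) \<Rightarrow> 'a \<Rightarrow> bool" where
  "global_solution F \<xi>\<^sub>0 \<longleftrightarrow> (\<forall>\<xi>. F \<xi>\<^sub>0 \<le> F \<xi>)"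

definition unique_global_solution :: "('a \<Rightarrow> real) \<Rightarrow> 'a \<Rightarrow> bool" where
  "unique_global_solution F \<xi>\<^sub>0 \<longleftrightarrow>
     global_solution F \<xi>\<^sub>0 \<and> (\<forall>\<xi>. global_solution F \<xi> \<longrightarrow> \<xi> = \<xi>\<^sub>0)"

end

theory Submission imports Defs begin

text \<open>
  The function \<open>\<xi> \<mapsto> l(0,t,x\<^sub>0,\<xi>,u)\<close> is nonnegative and vanishes at \<open>x\<^sub>0\<close>, so \<open>x\<^sub>0\<close> is the unique
  minimizer iff \<open>l(0,t,x\<^sub>0,\<xi>,u) > 0\<close> for all \<open>\<xi> \<noteq> x\<^sub>0\<close>. The integrand inherits piecewise continuity
  from the input, and as its value at each time of \<open>[0,t]\<close> is a one-sided limit from within \<open>[0,t]\<close>,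
  it has a positive integral as soon as it is nonzero somewhere.
\<close>

text \<open>Finitely many of the neighbourhoods with a local bound cover \<open>K\<close>. The
  filter at \<open>x\<close> within \<open>K\<close> ignores the point \<open>x\<close> itself, so
  the local bound is first enlarged to include \<open>norm (g x)\<close>.\<close>

lemma compact_locally_bounded_imp_bounded:
  fixes g :: "'a::topological_space \<Rightarrow> 'b::real_normed_vector"
  assumes "compact K"
    and loc: "\<And>x. x \<in> K \<Longrightarrow> \<exists>B. \<forall>\<^sub>F y in at x within K. norm (g y) \<le> B"
  shows "bounded (g ` K)"
proof -
  have "\<exists>S B. open S \<and> x \<in> S \<and> (\<forall>y\<in>S \<inter> K. norm (g y) \<le> B)" if x: "x \<in> K" for x
  proof -
    obtain B S where "open S" "x \<in> S" "\<forall>y\<in>S. y \<noteq> x \<longrightarrow> y \<in> K \<longrightarrow> norm (g y) \<le> B"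
      using loc[OF x] unfolding eventually_at_topological by metis
    then have "\<forall>y\<in>S \<inter> K. norm (g y) \<le> max B (norm (g x))"
      by (metis IntE max.coboundedI1 max.cobounded2)
    with \<open>open S\<close> \<open>x \<in> S\<close> show ?thesis by blast
  qed
  then obtain S B where S: "\<And>x. x \<in> K \<Longrightarrow> open (S x)" "\<And>x. x \<in> K \<Longrightarrow> x \<in> S x"
    and B: "\<And>x y. x \<in> K \<Longrightarrow> y \<in> S x \<inter> K \<Longrightarrow> norm (g y) \<le> B x"
    by metis
  obtain C where C: "C \<subseteq> K" "finite C" "K \<subseteq> (\<Union>x\<in>C. S x)"
    using compactE_image[OF \<open>compact K\<close>, of K S] S by blast
  have "bounded (\<Union>x\<in>C. g ` (S x \<inter> K))"
    using C B by (intro bounded_UN) (auto simp: bounded_iff image_iff subset_iff, blast)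
  then show ?thesis
    by (rule bounded_subset) (use C in blast)
qed

text \<open>A finite one-sided limit bounds \<open>g\<close> near each point on that side, and
  compactness of the interval turns these local bounds into a global one.\<close>

lemma piecewise_continuous_bounded:
  fixes g :: "real \<Rightarrow> 'a::real_normed_vector"
  assumes "piecewise_continuous g"
  shows "bounded (g ` {0..t})"
proof (rule compact_locally_bounded_imp_bounded)
  fix s :: real
  assume s: "s \<in> {0..t}"
  have lim_bdd: "\<exists>B. \<forall>\<^sub>F y in F. norm (g y) \<le> B" if "(g \<longlongrightarrow> l) F" for l and F :: "real filter"
    using order_tendstoD(2)[OF tendsto_norm[OF that], of "norm l + 1"]
    by (intro exI[of _ "norm l + 1"]) (auto elim: eventually_mono)
  obtain B where B: "\<forall>\<^sub>F y in at_right s. norm (g y) \<le> B"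
    using assms s lim_bdd unfolding piecewise_continuous_def by (metis atLeastAtMost_iff)
  show "\<exists>B. \<forall>\<^sub>F y in at s within {0..t}. norm (g y) \<le> B"
  \<comment> \<open>At time 0 there is no left limit to use, but all nearby points of
    \<open>{0..t}\<close> lie to the right.\<close>
  proof (cases "s = 0")
    case True
    have "at s within {0..t} \<le> at_right s"
      unfolding True at_within_def by (intro inf_mono order_refl) auto
    with B show ?thesis using filter_leD by blast
  next
    case False
    with s have "0 < s" by simp
    then obtain B' where B': "\<forall>\<^sub>F y in at_left s. norm (g y) \<le> B'"
      using assms lim_bdd unfolding piecewise_continuous_def by metis
    have "\<forall>\<^sub>F y in at s. norm (g y) \<le> max B B'"
      unfolding at_eq_sup_left_right eventually_sup
      using B B' by (auto elim!: eventually_mono)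
    then show ?thesis using at_le[of "{0..t}" UNIV s] filter_leD by blast
  qed
qed simp

text \<open>Off the finite set \<open>D\<close> of discontinuities, \<open>g\<close> is continuous,
  hence measurable, and it is dominated by a constant. The set \<open>D\<close> is negligible, so
  putting it back changes nothing.\<close>

lemma piecewise_continuous_integrable:
  fixes g :: "real \<Rightarrow> 'a::euclidean_space"
  assumes pc: "piecewise_continuous g"
  shows "g integrable_on {0..t}"
proof -
  define D where "D = {s \<in> {0..t}. \<not> continuous (at s within {0..}) g}"
  have "finite D" using pc unfolding piecewise_continuous_def D_def by blast
  obtain B where B: "\<And>s. s \<in> {0..t} \<Longrightarrow> norm (g s) \<le> B"
    using piecewise_continuous_bounded[OF pc, of t] unfolding bounded_iff by blast
  \<comment> \<open>Stated for arbitrary \<open>k\<close> because it is applied both to the constant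
    bound and to \<open>g\<close>.\<close>
  have spike: "k integrable_on {0..t} - D \<longleftrightarrow> k integrable_on {0..t}" for k :: "real \<Rightarrow> 'b::banach"
    using \<open>finite D\<close>
    by (intro integrable_spike_set_eq) (auto intro: negligible_finite finite_subset[of _ D])
  have cont: "continuous_on ({0..t} - D) g"
    unfolding continuous_on_eq_continuous_within D_def
    by (auto intro: continuous_within_subset)
  have meas: "{0..t} - D \<in> sets lebesgue"
    using \<open>finite D\<close> by (intro sets.Diff) (auto intro: negligible_imp_sets negligible_finite)
  have "g integrable_on {0..t} - D"
  proof (rule measurable_bounded_by_integrable_imp_integrable)
    show "g \<in> borel_measurable (lebesgue_on ({0..t} - D))"
      by (rule continuous_imp_measurable_on_sets_lebesgue[OF cont meas])
    show "(\<lambda>_. B) integrable_on {0..t} - D"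
      unfolding spike by (rule integrable_const_ivl)
  qed (use B meas in auto)
  then show ?thesis by (simp only: spike)
qed

text \<open>Serves to pass to one-sided limits at a jump of the input, where \<open>l\<close> may
  differ from \<open>u s\<close> while the state \<open>x\<close> stays continuous.\<close>

lemma tendsto_compose_Pair:
  fixes F :: "'a::t2_space \<times> 'b::t2_space \<Rightarrow> 'c::t2_space"
  assumes F: "continuous_on UNIV F" and x: "continuous (at s within A) x"
    and u: "(u \<longlongrightarrow> l) (at s within A)"
  shows "((\<lambda>s. F (x s, u s)) \<longlongrightarrow> F (x s, l)) (at s within A)"
proof (rule isCont_tendsto_compose[of "(x s, l)" F])
  show "isCont F (x s, l)" using F by (simp add: continuous_on_eq_continuous_at)
  show "((\<lambda>s. (x s, u s)) \<longlongrightarrow> (x s, l)) (at s within A)"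
    using x u by (intro tendsto_Pair) (auto simp: continuous_within)
qed

lemma continuous_within_compose_Pair:
  fixes F :: "'a::t2_space \<times> 'b::t2_space \<Rightarrow> 'c::t2_space"
  assumes "continuous_on UNIV F" "continuous (at s within A) x" "continuous (at s within A) u"
  shows "continuous (at s within A) (\<lambda>s. F (x s, u s))"
  using assms tendsto_compose_Pair[of F s A x u "u s"] by (simp add: continuous_within)

text \<open>Since \<open>x\<close> is continuous, the composite can jump only where \<open>u\<close>
  does, and at a jump it is continuous from whichever side \<open>u\<close> is.\<close>

lemma piecewise_continuous_compose:
  fixes F :: "'a::t2_space \<times> 'b::t2_space \<Rightarrow> 'c::t2_space"
  assumes F: "continuous_on UNIV F" and x: "continuous_on {0..} x"
    and u: "piecewise_continuous u"
  shows "piecewise_continuous (\<lambda>s. F (x s, u s))"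
proof -
  note cont = continuous_within_compose_Pair[OF F] and lim = tendsto_compose_Pair[OF F]
  have x0: "continuous (at s within {0..}) x" if "s \<ge> 0" for s
    using x that by (simp add: continuous_on_eq_continuous_within)
  have xr: "continuous (at_right s) x" if "s \<ge> 0" for s
    using x0[OF that] by (rule continuous_within_subset) (use that in auto)
  have xl: "continuous (at_left s) x" if "s > 0" for s
    using continuous_on_interior[OF x, of s] that by (auto intro: continuous_within_subset)
  show ?thesis
    unfolding piecewise_continuous_def
  proof (intro conjI allI impI)
    fix T :: real
    have "finite {s \<in> {0..T}. \<not> continuous (at s within {0..}) u}"
      using u unfolding piecewise_continuous_def by blast
    then show "finite {s \<in> {0..T}. \<not> continuous (at s within {0..}) (\<lambda>s. F (x s, u s))}"
      by (rule rev_finite_subset) (auto intro: cont x0)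
  next
    fix s :: real assume "s \<ge> 0"
    then show "\<exists>l. ((\<lambda>s. F (x s, u s)) \<longlongrightarrow> l) (at_right s)"
      using u lim xr unfolding piecewise_continuous_def by metis
  next
    fix s :: real assume "s > 0"
    then show "\<exists>l. ((\<lambda>s. F (x s, u s)) \<longlongrightarrow> l) (at_left s)"
      using u lim xl unfolding piecewise_continuous_def by metis
  next
    fix s :: real assume "s \<ge> 0"
    then show "continuous (at_right s) (\<lambda>s. F (x s, u s)) \<or>
        0 < s \<and> continuous (at_left s) (\<lambda>s. F (x s, u s))"
      using u cont xl xr unfolding piecewise_continuous_def by metis
  qed
qed

text \<open>On the side from which \<open>g\<close> is continuous at \<open>s\<close>, it stays
  above half of \<open>g s\<close> on an interval of positive length. The assumption
  \<open>left\<close> guarantees that for \<open>s = t\<close> this side lies within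
  \<open>{0..t}\<close>.\<close>

lemma piecewise_continuous_nonneg_integral_pos:
  fixes g :: "real \<Rightarrow> real"
  assumes pc: "piecewise_continuous g" and nonneg: "\<And>s. g s \<ge> 0"
    and "t > 0" and left: "continuous (at_left t) g"
    and s: "s \<in> {0..t}" "g s \<noteq> 0"
  shows "integral {0..t} g > 0"
proof -
  have gs: "g s / 2 < g s" "0 < g s" using nonneg[of s] s by auto
  have "\<exists>c d. 0 \<le> c \<and> c < d \<and> d \<le> t \<and> (\<forall>y\<in>{c..d}. g s / 2 < g y)"
  \<comment> \<open>If this fails, then either \<open>s = t\<close>, where \<open>left\<close>
    applies, or \<open>g\<close> is not right continuous at \<open>s\<close>, and piecewise
    continuity gives \<open>0 < s\<close> and left continuity.\<close>
  proof (cases "s < t \<and> continuous (at_right s) g")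
    case True
    then have "\<forall>\<^sub>F y in at_right s. g s / 2 < g y"
      using order_tendstoD(1)[OF _ gs(1)] by (auto simp: continuous_within)
    then obtain b where "b > s" "\<forall>y>s. y < b \<longrightarrow> g s / 2 < g y"
      unfolding eventually_at_right_field by blast
    \<comment> \<open>The bound is known only strictly between \<open>s\<close> and
      \<open>b\<close>, so both endpoints of the closed interval \<open>{c..d}\<close> are taken
      strictly inside.\<close>
    moreover obtain d where "s < d" "d < min b t"
      using dense[of s "min b t"] True \<open>b > s\<close> by auto
    moreover obtain c where "s < c" "c < d" using dense[OF \<open>s < d\<close>] by blast
    ultimately show ?thesis
      using s by (intro exI[of _ c] exI[of _ d]) auto
  next
    case False
    then have "s > 0" "continuous (at_left s) g"
      using pc s left \<open>t > 0\<close> unfolding piecewise_continuous_def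
      by (metis atLeastAtMost_iff order_le_less)+
    then have "\<forall>\<^sub>F y in at_left s. g s / 2 < g y"
      using order_tendstoD(1)[OF _ gs(1)] by (auto simp: continuous_within)
    then obtain b where "b < s" "\<forall>y>b. y < s \<longrightarrow> g s / 2 < g y"
      unfolding eventually_at_left_field by blast
    moreover obtain c where "max b 0 < c" "c < s"
      using dense[of "max b 0" s] \<open>b < s\<close> \<open>s > 0\<close> by auto
    moreover obtain d where "c < d" "d < s" using dense[OF \<open>c < s\<close>] by blast
    ultimately show ?thesis
      using s by (intro exI[of _ c] exI[of _ d]) auto
  qed
  then obtain c d where cd: "0 \<le> c" "c < d" "d \<le> t" and gcd: "\<And>y. y \<in> {c..d} \<Longrightarrow> g s / 2 < g y"
    by blast
  have int: "g integrable_on {0..t}" using pc by (rule piecewise_continuous_integrable)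
  have int': "g integrable_on {c..d}"
    using integrable_on_subinterval[OF int] cd by auto
  have "0 < (d - c) * (g s / 2)" using cd gs by simp
  also have "\<dots> = integral {c..d} (\<lambda>_. g s / 2)" using cd by simp
  also have "\<dots> \<le> integral {c..d} g"
    by (rule integral_le) (use int' gcd in \<open>auto intro: less_imp_le\<close>)
  also have "\<dots> \<le> integral {0..t} g"
    by (rule integral_subset_le) (use int int' cd nonneg in auto)
  finally show ?thesis .
qed

lemma twice_cont_diff_imp_continuous_on: "twice_cont_diff h \<Longrightarrow> continuous_on S h"
  unfolding twice_cont_diff_def
  by (metis continuous_at_imp_continuous_on has_derivative_continuous)

text \<open>Two solutions may differ before \<open>s1\<close>, so it is the value at
  \<open>s\<close>, not the solution as a function, that is unique and can be picked by
  \<open>THE\<close>.\<close>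

lemma \<phi>_eq_solution:
  assumes "solutions_uniquely_defined U f" "input_trajectory U u" "0 \<le> s1"
    and "is_solution f s1 \<xi> u x" "s1 \<le> s"
  shows "\<phi> f s s1 \<xi> u = x s"
  unfolding \<phi>_def
  by (rule the_equality) (use assms in \<open>unfold solutions_uniquely_defined_def, blast+\<close>)

lemma \<phi>_continuous_on:
  assumes "solutions_uniquely_defined U f" "input_trajectory U u" "0 \<le> s1"
  shows "continuous_on {s1..} (\<lambda>s. \<phi> f s s1 \<xi> u)"
proof -
  obtain x where x: "is_solution f s1 \<xi> u x"
    using assms unfolding solutions_uniquely_defined_def by blast
  then have "continuous_on {s1..} x" unfolding is_solution_def by blast
  then show ?thesis
    by (rule continuous_on_eq) (use \<phi>_eq_solution[OF assms x] in auto)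
qed

text \<open>For \<open>t = 0\<close> every integral vanishes, although an injective output map could
  already separate initial states. If \<open>u\<close> jumps at \<open>t\<close> and takes its right
  limit there, two outputs may differ at \<open>t\<close> alone, which the integral cannot see. The
  last two assumptions exclude these cases.\<close>

theorem proposition3p3:
  fixes U :: "(real ^ 'nu) set"
    and f :: "(real ^ 'nx) \<times> (real ^ 'nu) \<Rightarrow> real ^ 'nx"
    and h :: "(real ^ 'nx) \<times> (real ^ 'nu) \<Rightarrow> real ^ 'ny"
    and u :: "real \<Rightarrow> real ^ 'nu"
    and t :: real
  assumes "twice_cont_diff f" and "twice_cont_diff h"
    and "solutions_uniquely_defined U f"
    and "input_trajectory U u"
    and "t > 0" and "continuous (at_left t) u"
  shows "universal_input_trajectory f h u t \<longleftrightarrow>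
    (\<forall>x\<^sub>0. unique_global_solution (\<lambda>\<xi>. cumulative_output_error f h 0 t x\<^sub>0 \<xi> u) x\<^sub>0)"
proof -
  let ?l = "\<lambda>\<xi>1 \<xi>2. cumulative_output_error f h 0 t \<xi>1 \<xi>2 u"
  define y where "y = (\<lambda>\<xi> s. h (\<phi> f s 0 \<xi> u, u s))"
  have l: "?l \<xi>1 \<xi>2 = integral {0..t} (\<lambda>s. (norm (y \<xi>1 s - y \<xi>2 s))\<^sup>2)" for \<xi>1 \<xi>2
    unfolding cumulative_output_error_def y_def ..
  have l_refl: "?l \<xi> \<xi> = 0" for \<xi> unfolding l by simp
  \<comment> \<open>Integrability need not be checked here: the integral of a non-integrable
    function is 0 by default.\<close>
  have l_nonneg: "?l \<xi>1 \<xi>2 \<ge> 0" for \<xi>1 \<xi>2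
    unfolding l by (metis (mono_tags, lifting) integral_nonneg not_integrable_integral order_refl zero_le_power2)
  have l_pos_iff: "?l \<xi>1 \<xi>2 > 0 \<longleftrightarrow> (\<exists>s\<in>{0..t}. y \<xi>1 s \<noteq> y \<xi>2 s)" for \<xi>1 \<xi>2
  proof
    assume "?l \<xi>1 \<xi>2 > 0"
    show "\<exists>s\<in>{0..t}. y \<xi>1 s \<noteq> y \<xi>2 s"
    proof (rule ccontr)
      assume "\<not> ?thesis"
      then have "?l \<xi>1 \<xi>2 = integral {0..t} (\<lambda>s. 0)"
        unfolding l by (intro integral_cong) auto
      with \<open>?l \<xi>1 \<xi>2 > 0\<close> show False by simp
    qed
  next
    assume "\<exists>s\<in>{0..t}. y \<xi>1 s \<noteq> y \<xi>2 s"
    then obtain s where s: "s \<in> {0..t}" "y \<xi>1 s \<noteq> y \<xi>2 s" by blast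
    \<comment> \<open>Pairing the two trajectories writes the integrand as a continuous
      \<open>F\<close> of a continuous state and the input, the form that the composition lemmas
      treat.\<close>
    define x where "x = (\<lambda>s. (\<phi> f s 0 \<xi>1 u, \<phi> f s 0 \<xi>2 u))"
    define F where "F = (\<lambda>((a, b), c). (norm (h (a, c) - h (b, c)))\<^sup>2)"
    have F: "continuous_on UNIV F"
      unfolding F_def case_prod_beta
      by (intro continuous_intros continuous_on_compose2[OF
            twice_cont_diff_imp_continuous_on[OF assms(2), of UNIV]]) auto
    have x: "continuous_on {0..} x"
      unfolding x_def using assms by (intro continuous_on_Pair \<phi>_continuous_on) auto
    have g: "(\<lambda>s. (norm (y \<xi>1 s - y \<xi>2 s))\<^sup>2) = (\<lambda>s. F (x s, u s))"
      by (simp add: y_def F_def x_def)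
    show "?l \<xi>1 \<xi>2 > 0"
      unfolding l
    proof (rule piecewise_continuous_nonneg_integral_pos[OF _ _ \<open>t > 0\<close> _ s(1)])
      show "piecewise_continuous (\<lambda>s. (norm (y \<xi>1 s - y \<xi>2 s))\<^sup>2)"
        unfolding g using assms(4)
        by (intro piecewise_continuous_compose F x) (simp add: input_trajectory_def)
      have "continuous (at_left t) x"
        using continuous_on_interior[OF x, of t] \<open>t > 0\<close> by (auto intro: continuous_within_subset)
      then show "continuous (at_left t) (\<lambda>s. (norm (y \<xi>1 s - y \<xi>2 s))\<^sup>2)"
        unfolding g using assms(6) by (rule continuous_within_compose_Pair[OF F])
    qed (use s in auto)
  qed
  have "unique_global_solution (?l x\<^sub>0) x\<^sub>0 \<longleftrightarrow> (\<forall>\<xi>. x\<^sub>0 \<noteq> \<xi> \<longrightarrow> ?l x\<^sub>0 \<xi> > 0)" for x\<^sub>0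
  proof -
    \<comment> \<open>The minimum is 0, attained at \<open>x\<^sub>0\<close>, so the minimizers are
      exactly the zeros.\<close>
    have "global_solution (?l x\<^sub>0) \<xi> \<longleftrightarrow> \<not> ?l x\<^sub>0 \<xi> > 0" for \<xi>
      unfolding global_solution_def using l_refl l_nonneg by (metis linorder_not_less order_trans)
    then show ?thesis
      unfolding unique_global_solution_def using l_refl by (metis less_irrefl)
  qed
  then show ?thesis
    unfolding universal_input_trajectory_def l_pos_iff by (simp add: y_def)
qed

end
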